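(* Let $D$ be a principal ideal domain with infinitely many prime ideals of finite index. For each integer $N \ge 2$ there exists an irreducible element $F \in \operatorname{Int}(D)$ such that (a) $F^n$ factors uniquely in $\operatorname{Int}(D)$ for all positive integers $n < N$, and (b) $F^N$ has exactly two essentially different factorizations in $\operatorname{Int}(D)$, one of length $2$ and one of length $N$.
   Context: For an integral domain $D$ with quotient field $K$, $\operatorname{Int}(D) = \{F \in K[x] \mid F(D) \subseteq D\}$ denotes the ring of integer-valued polynomials on $D$, a subring of $K[x]$. A prime ideal $P$ of $D$ has finite index if the residue ring $D/P$ is finite. For an element $r$ of a commutative ring, a factorization of $r$ is an expression $r = c_1 \cdots c_k$ of $r$ as a product of irreducible elements; the number $k$ of irreducible factors is the length of the factorization. Two factorizations of an element are essentially the same if their factors are equal up to permutation and multiplication by units (of the ring), and essentially different otherwise. An element factors uniquely if it has exactly one factorization, where factorizations that are essentially the same are identified. *)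

theory Defs
  imports
    "HOL-Algebra.Ring_Divisibility"
    "HOL-Algebra.Algebraic_Closure_Type"
    "HOL-Computational_Algebra.Fraction_Field"
    "HOL-Computational_Algebra.Polynomial_Factorial"
begin

text \<open>
  The integral domain \<open>D\<close> is a type of class \<open>idom\<close>, its quotient field is the type
  \<open>'a fract\<close>, and \<open>to_fract\<close> is the embedding of \<open>D\<close> into it.
  Ideals, residue rings, irreducibility and factorizations are those of HOL-Algebra.
\<close>

definition Int_ring :: "'a::idom fract poly ring" where
  "Int_ring = ring_of_type_algebra
     \<lparr>carrier := {F. \<forall>d. poly F (to_fract d) \<in> range (to_fract :: 'a \<Rightarrow> 'a fract)}\<rparr>"

text \<open>
  The predicates \<open>factors\<close> and \<open>irreducible\<close> do not restrict their arguments to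
  the carrier, so the condition on the carrier is part of the definition.
\<close>

definition factorizations :: "('a, 'b) ring_scheme \<Rightarrow> 'a \<Rightarrow> 'a list set" where
  "factorizations R r = {cs. set cs \<subseteq> carrier R \<and> factors R cs r}"

text \<open>
  Factorizations are identified when they are \<open>essentially_equal\<close>, i.e. equal up to
  permutation and associated factors; in a domain, associated elements are exactly those
  that differ by a unit (\<open>domain.ring_associated_iff\<close>).
\<close>

definition factors_uniquely :: "('a, 'b) ring_scheme \<Rightarrow> 'a \<Rightarrow> bool" where
  "factors_uniquely R r \<longleftrightarrow>
     (\<exists>cs \<in> factorizations R r. \<forall>ds \<in> factorizations R r. essentially_equal R ds cs)"

lemma Int_ring_simps [simp]:
  "carrier Int_ring = {F. \<forall>d. poly F (to_fract d) \<in> range (to_fract :: 'a::idom \<Rightarrow> 'a fract)}"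
  "F \<otimes>\<^bsub>Int_ring\<^esub> G = F * G" "F \<oplus>\<^bsub>Int_ring\<^esub> G = F + G"
  "\<one>\<^bsub>Int_ring\<^esub> = 1" "\<zero>\<^bsub>Int_ring\<^esub> = 0"
  by (simp_all add: Int_ring_def ring_of_type_algebra_def)

lemma domain_Int_ring: "domain (Int_ring :: 'a::idom fract poly ring)"
proof -
  have closed: "x + y \<in> range to_fract" "x * y \<in> range to_fract" "- x \<in> range to_fract"
    if "x \<in> range to_fract" "y \<in> range to_fract" for x y :: "'a fract"
    using that by (auto simp flip: to_fract_add to_fract_mult to_fract_uminus)
  have "0 \<in> range (to_fract :: 'a \<Rightarrow> _)" "1 \<in> range (to_fract :: 'a \<Rightarrow> _)"
    by (metis rangeI to_fract_0, metis rangeI to_fract_1)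
  note closed = closed this
  have "cring (Int_ring :: 'a fract poly ring)"
  proof (rule cringI)
    show "abelian_group (Int_ring :: 'a fract poly ring)"
    proof (rule abelian_groupI)
      fix F :: "'a fract poly" assume "F \<in> carrier Int_ring"
      then show "\<exists>G\<in>carrier Int_ring. G \<oplus>\<^bsub>Int_ring\<^esub> F = \<zero>\<^bsub>Int_ring\<^esub>"
        by (intro bexI[of _ "- F"]) (use closed in auto)
    qed (use closed in \<open>auto simp: algebra_simps\<close>)
    show "comm_monoid (Int_ring :: 'a fract poly ring)"
      by (rule comm_monoidI) (use closed in \<open>auto simp: algebra_simps\<close>)
  qed (auto simp: algebra_simps)
  then show ?thesis
    by (rule domain.intro) (auto simp: domain_axioms_def)
qed

end

theory Submission
  imports Defs
begin

text \<open>
  Let \<open>p\<close> be a prime element of \<open>D\<close> with finite residue field and \<open>r\<close> a prime element that is not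
  associated to \<open>p\<close>. There are polynomials \<open>f\<close>, \<open>g\<close>, \<open>h\<close> over \<open>D\<close>, irreducible over the quotient field \<open>K\<close>, with
  the following values:

  \<^item> \<open>p\<close> divides \<open>f(d)\<close> and \<open>p ^ (N - 1)\<close> divides \<open>g(d)\<close> if \<open>p\<close> divides \<open>d\<close>; these are the exact powers
    of \<open>p\<close> at \<open>d = 0\<close>, and \<open>p\<close> does not divide \<open>h(0)\<close>;
  \<^item> \<open>p ^ N\<close> divides \<open>h(d)\<close> if \<open>p\<close> does not divide \<open>d\<close>; moreover \<open>f(1) = g(1) = 1\<close> and \<open>h(1) = p ^ N\<close>.

  So the highest power of \<open>p\<close> that can be divided out of \<open>f ^ a * g ^ b * h ^ e\<close> inside \<open>Int(D)\<close> has as exponent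
  the minimum of \<open>a + (N - 1) * b\<close> and \<open>N * e\<close>, the valuations at \<open>0\<close> and at \<open>1\<close>, and no other prime can be
  divided out, since the value at \<open>1\<close> is a power of \<open>p\<close>. Let \<open>a + (N - 1) * b = N * e\<close> and consider
  \<open>f ^ a * g ^ b * h ^ e / p ^ (N * e)\<close>. In a factorization of this element in \<open>Int(D)\<close> no power of \<open>p\<close> can be
  lost, neither at \<open>0\<close> nor at \<open>1\<close>, and therefore the exponents of each factor satisfy the same
  equation (lemma \<open>split_block\<close>). Thus the divisors of such elements form, up to units, the monoid of
  pairs \<open>(a, b)\<close> with \<open>a \<equiv> b\<close> modulo \<open>N\<close>. Its indecomposable elements are \<open>(1, 1)\<close>, \<open>(N, 0)\<close> and
  \<open>(0, N)\<close>, and \<open>N * (1, 1) = (N, 0) + (0, N)\<close> is the only relation between them. The theorem follows for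
  \<open>F = f * g * h / p ^ N\<close>, which belongs to \<open>(1, 1)\<close>.

  The finite residue field at \<open>p\<close> is used for \<open>h\<close>, which needs an exponent \<open>m\<close> with \<open>d ^ m \<equiv> 1\<close> modulo \<open>p\<close>
  for all \<open>d\<close> prime to \<open>p\<close>. The prime \<open>r\<close> is used for the irreducibility of \<open>g\<close> and \<open>h\<close>, by
  Eisenstein's criterion.
\<close>

section \<open>Primes in a principal ideal domain\<close>

lemma ring_of_type_algebra_simps [simp]:
  "carrier ring_of_type_algebra = UNIV"
  "x \<otimes>\<^bsub>ring_of_type_algebra\<^esub> y = x * y"
  "x \<oplus>\<^bsub>ring_of_type_algebra\<^esub> y = x + y"
  "\<one>\<^bsub>ring_of_type_algebra\<^esub> = 1"
  "\<zero>\<^bsub>ring_of_type_algebra\<^esub> = 0"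
  by (simp_all add: ring_of_type_algebra_def)

lemma PIdl_type_algebra: "PIdl\<^bsub>ring_of_type_algebra\<^esub> a = {x::'a::idom. a dvd x}"
  by (auto simp: cgenideal_def mult.commute elim!: dvdE)

lemma pid_ideal_generator:
  assumes "principal_domain (ring_of_type_algebra :: 'a::idom ring)"
    and "ideal I (ring_of_type_algebra :: 'a ring)"
  obtains a where "I = {x. a dvd x}"
  using principal_domain.exists_gen[OF assms] by (auto simp: PIdl_type_algebra)

lemma prime_ideal_generator:
  assumes "principal_domain (ring_of_type_algebra :: 'a::idom ring)"
    and "primeideal P (ring_of_type_algebra :: 'a ring)" "P \<noteq> {0}"
  obtains p where "prime_elem p" "P = {x. p dvd x}"
proof -
  let ?D = "ring_of_type_algebra :: 'a ring"
  interpret primeideal P ?D by fact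
  obtain p where p: "P = {x. p dvd x}"
    using pid_ideal_generator[OF assms(1) is_ideal] by blast
  have "prime_elem p"
  proof (rule prime_elemI)
    show "p \<noteq> 0" using assms(3) by (auto simp: p)
    show "\<not> p dvd 1" using I_notcarr by (auto simp: p intro: dvd_trans)
    show "p dvd a \<or> p dvd b" if "p dvd a * b" for a b
      using I_prime[of a b] that by (simp add: p)
  qed
  with p show ?thesis using that by blast
qed

lemma prime_elem_dvd_prime_elem:
  fixes p r :: "'a::idom"
  assumes "prime_elem p" "prime_elem r" "r dvd p"
  shows "p dvd r"
proof -
  obtain c where c: "p = r * c" using assms(3) by (elim dvdE)
  then have "p dvd r \<or> p dvd c" using assms(1) by (metis dvd_refl prime_elem_dvd_mult_iff)
  moreover have "\<not> p dvd c"
  proof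
    assume "p dvd c"
    then have "p * r dvd p * 1" using c by (metis mult.commute mult.right_neutral mult_dvd_mono dvd_refl)
    then have "r dvd 1" using assms(1) by (simp add: dvd_mult_cancel_left prime_elem_def)
    then show False using assms(2) prime_elem_not_unit by blast
  qed
  ultimately show ?thesis by blast
qed

text \<open>
  If every power of \<open>r\<close> divided \<open>d\<close>, then the quotients \<open>d / r ^ k\<close> would generate a strictly
  increasing chain of principal ideals. Its union is the ideal \<open>J\<close> in the proof, and the
  contradiction comes from a generator of \<open>J\<close>.
\<close>

lemma pid_power_not_dvd:
  assumes pid: "principal_domain (ring_of_type_algebra :: 'a::idom ring)"
    and r: "\<not> r dvd 1" and d: "(d::'a) \<noteq> 0"
  shows "\<exists>n. \<not> r ^ n dvd d"
proof (rule ccontr)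
  assume "\<not> ?thesis"
  then have all: "r ^ n dvd d" for n by blast
  let ?D = "ring_of_type_algebra :: 'a ring"
  define J where "J = {x. \<exists>k. d dvd r ^ k * x}"
  have mono: "d dvd r ^ k * x \<Longrightarrow> k \<le> l \<Longrightarrow> d dvd r ^ l * x" for k l x
    by (meson dvd_trans le_imp_power_dvd mult_dvd_mono dvd_refl)
  have add: "x + y \<in> J" if xy: "x \<in> J" "y \<in> J" for x y
  proof -
    obtain k l where "d dvd r ^ k * x" "d dvd r ^ l * y" using xy by (auto simp: J_def)
    then have "d dvd r ^ max k l * x" "d dvd r ^ max k l * y" using mono by auto
    then have "d dvd r ^ max k l * (x + y)" by (simp add: distrib_left)
    then show ?thesis by (auto simp: J_def)
  qed
  have mult: "x * y \<in> J" if "x \<in> J" for x y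
    using that by (auto simp: J_def simp flip: mult.assoc intro: dvd_mult2)
  have inv: "\<ominus>\<^bsub>?D\<^esub> x = - x" for x :: 'a
    using cring.cring_simprules(17)[OF cring_from_type_algebra, of x]
      abelian_group.minus_equality[OF ring.is_abelian_group[OF ring_from_type_algebra], of "- x" x]
    by simp
  have "ideal J ?D"
  proof (rule idealI)
    show "subgroup J (add_monoid ?D)"
    proof (unfold_locales, goal_cases)
      case (4 x)
      then show ?case using mult[of x "- 1"] inv by (simp add: a_inv_def)
    qed (use add in \<open>auto simp: J_def\<close>)
  qed (use mult in \<open>auto simp: mult.commute\<close>)
  from pid_ideal_generator[OF pid this] obtain j where j: "J = {x. j dvd x}" .
  then have "j \<in> J" by simp
  then obtain k where k: "d dvd r ^ k * j" by (auto simp: J_def)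
  obtain y where y: "d = r ^ Suc k * y" using all[of "Suc k"] by (elim dvdE)
  then have "y \<in> J" unfolding J_def by (auto intro: exI[of _ "Suc k"])
  then have "r ^ k * j * r dvd r ^ k * y * r" using j by (intro mult_dvd_mono) auto
  also have "\<dots> = d" by (simp add: y algebra_simps)
  also note k
  finally have "r ^ k * j * r dvd r ^ k * j * 1" by simp
  moreover have "j \<noteq> 0" using \<open>y \<in> J\<close> y d j by auto
  moreover have "r \<noteq> 0" using y d by auto
  ultimately show False using r by (simp add: dvd_mult_cancel_left)
qed

text \<open>
  Among the residues of the powers of \<open>d\<close>, where \<open>p\<close> does not divide \<open>d\<close>, two coincide, by the pigeonhole principle, and cancelling
  the smaller one gives an exponent at most \<open>card (D / p)\<close> that works for this \<open>d\<close>. The factorial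
  of that number is a multiple of all these exponents, so that it works for every \<open>d\<close>.
\<close>

lemma finite_residues_exponent:
  fixes p :: "'a::idom"
  assumes p: "prime_elem p"
    and fin: "finite (carrier ((ring_of_type_algebra :: 'a ring) Quot {x. p dvd x}))"
  shows "\<exists>m>0. \<forall>d. \<not> p dvd d \<longrightarrow> p dvd d ^ m - 1"
proof -
  let ?D = "ring_of_type_algebra :: 'a ring" and ?P = "{x. p dvd x}"
  let ?Q = "carrier (?D Quot ?P)"
  define c where "c = (\<lambda>x. ?P +>\<^bsub>?D\<^esub> x)"
  have c_in: "c x \<in> ?Q" for x
    by (auto simp: c_def FactRing_def A_RCOSETS_def' a_r_coset_def')
  have c_eq: "p dvd x - y" if "c x = c y" for x y
  proof -
    have "x \<in> c x" by (auto simp: c_def a_r_coset_def')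
    then show ?thesis unfolding that by (auto simp: c_def a_r_coset_def')
  qed
  have "p dvd d ^ fact (card ?Q) - 1" if d: "\<not> p dvd d" for d
  proof -
    have "\<not> inj_on (\<lambda>n. c (d ^ n)) {..card ?Q}"
    proof
      assume "inj_on (\<lambda>n. c (d ^ n)) {..card ?Q}"
      then have "card {..card ?Q} \<le> card ?Q"
        by (rule card_inj_on_le) (use c_in fin in auto)
      then show False by simp
    qed
    then obtain i j where ij: "i < j" "j \<le> card ?Q" "c (d ^ j) = c (d ^ i)"
      unfolding inj_on_def by (metis atMost_iff linorder_neqE_nat)
    have "d ^ j - d ^ i = d ^ i * (d ^ (j - i) - 1)"
      using ij(1) by (simp add: right_diff_distrib flip: power_add)
    then have "p dvd d ^ i * (d ^ (j - i) - 1)" using c_eq[OF ij(3)] by simp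
    moreover have "\<not> p dvd d ^ i" using d p prime_elem_dvd_power by blast
    ultimately have *: "p dvd d ^ (j - i) - 1" using p by (simp add: prime_elem_dvd_mult_iff)
    have "j - i dvd fact (card ?Q)" using ij by (intro dvd_fact) auto
    then obtain l where "fact (card ?Q) = (j - i) * l" by (elim dvdE)
    then have "d ^ fact (card ?Q) - 1 = (d ^ (j - i)) ^ l - 1" by (simp add: power_mult)
    also have "d ^ (j - i) - 1 dvd \<dots>" by (simp add: power_diff_1_eq)
    finally show ?thesis using * dvd_trans by blast
  qed
  moreover have "fact (card ?Q) > (0::nat)" by simp
  ultimately show ?thesis by blast
qed

section \<open>Polynomials over a domain and over its quotient field\<close>

lemma Int_ring_carrierI:
  "(\<And>d. \<exists>c. poly F (to_fract d) = to_fract c) \<Longrightarrow> F \<in> carrier (Int_ring :: 'a::idom fract poly ring)"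
  by (simp add: image_iff)

lemma poly_fract_poly [simp]: "poly (fract_poly P) (to_fract d) = to_fract (poly P d)"
  by (induction P) (simp_all add: map_poly_pCons)

lemma fract_poly_power: "fract_poly (P ^ n) = fract_poly P ^ n"
  by (induction n) simp_all

lemma to_fract_power: "to_fract (x ^ n) = to_fract x ^ n"
  by (induction n) simp_all

lemma common_denominator:
  fixes A :: "'a::idom fract poly"
  obtains d B where "d \<noteq> 0" "smult (to_fract d) A = fract_poly B"
proof -
  have "\<exists>d B. d \<noteq> 0 \<and> smult (to_fract d) A = fract_poly B"
  proof (induction A)
    case 0
    show ?case by (intro exI[of _ 1] exI[of _ 0]) simp
  next
    case (pCons a A)
    then obtain d B where dB: "d \<noteq> 0" "smult (to_fract d) A = fract_poly B" by blast
    obtain x y where a: "a = to_fract x / to_fract y" "y \<noteq> 0"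
      by (cases a) (auto simp: Fract_conv_to_fract)
    have "smult (to_fract (d * y)) A = smult (to_fract y) (fract_poly B)"
      by (simp add: dB flip: mult.commute[of "to_fract y"] smult_smult)
    then have "smult (to_fract (d * y)) (pCons a A) = fract_poly (pCons (d * x) (smult y B))"
      using a by (simp add: map_poly_pCons)
    moreover have "d * y \<noteq> 0" using dB a by simp
    ultimately show ?case by blast
  qed
  then show ?thesis using that by blast
qed

text \<open>
  Eisenstein's criterion for polynomials over \<open>D\<close> up to a scalar \<open>d\<close>, which will be the common
  denominator of a factorization over the quotient field. Gauss's lemma enters only at the
  prime \<open>r\<close>: a factor \<open>r\<close> of \<open>d\<close> divides one of \<open>A\<close>, \<open>B\<close> because the constant polynomial \<open>r\<close> is prime,
  and it can be cancelled. The bound on the power of \<open>r\<close> in \<open>d\<close> makes this process stop.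
\<close>

lemma eisenstein_integral:
  fixes P A B :: "'a::idom poly"
  assumes r: "prime_elem r"
    and d: "\<not> r ^ n dvd d"
    and eq: "smult d P = A * B"
    and low: "\<And>i. i < degree P \<Longrightarrow> r dvd coeff P i"
    and lead: "\<not> r dvd lead_coeff P"
    and const: "\<not> r\<^sup>2 dvd coeff P 0"
  shows "degree A = 0 \<or> degree B = 0"
  using d eq
proof (induction n arbitrary: d A B)
  case 0
  then show ?case by simp
next
  case (Suc n)
  have r0: "r \<noteq> 0" using r by auto
  show ?case
  proof (cases "r dvd d")
    case True
    then obtain d' where d': "d = r * d'" by (elim dvdE)
    have n: "\<not> r ^ n dvd d'" using Suc.prems(1) r0 by (simp add: d')
    have "[:r:] dvd A * B"
      by (intro dvdI[of _ _ "smult d' P"]) (simp add: d' mult.commute flip: Suc.prems(2))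
    then consider A' where "A = smult r A'" | B' where "B = smult r B'"
      using lift_prime_elem_poly[OF r] by (auto simp: prime_elem_dvd_mult_iff elim!: dvdE)
    then show ?thesis
    proof cases
      case 1
      then have "smult r (smult d' P) = smult r (A' * B)"
        using Suc.prems(2) by (simp add: d')
      then have "smult d' P = A' * B" using r0 by (simp only: smult_cancel)
      from Suc.IH[OF n this] show ?thesis using 1 by auto
    next
      case 2
      then have "smult r (smult d' P) = smult r (A * B')"
        using Suc.prems(2) by (simp add: d')
      then have "smult d' P = A * B'" using r0 by (simp only: smult_cancel)
      from Suc.IH[OF n this] show ?thesis using 2 by auto
    qed
  next
    case False
    \<comment> \<open>The usual argument: \<open>V\<close> is the factor whose constant term is prime to \<open>r\<close>, and the lowest
        coefficient of \<open>U\<close> that is prime to \<open>r\<close> survives modulo \<open>r\<close> in the product.\<close>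
    have main: "degree V = 0"
      if eq: "smult d P = U * V" and V0: "\<not> r dvd coeff V 0" for U V
    proof (rule ccontr)
      assume deg: "degree V \<noteq> 0"
      have "d * lead_coeff P = lead_coeff U * lead_coeff V"
        using arg_cong[OF eq, of lead_coeff] False
        by (auto simp: lead_coeff_mult split: if_splits)
      then have lU: "\<not> r dvd lead_coeff U"
        using r False lead by (metis dvd_mult2 prime_elem_dvd_mult_iff)
      define i where "i = (LEAST i. \<not> r dvd coeff U i)"
      have i: "\<not> r dvd coeff U i" unfolding i_def using lU by (rule LeastI)
      have less: "r dvd coeff U j" if "j < i" for j
        using not_less_Least that unfolding i_def by blast
      have "i \<le> degree U" unfolding i_def using lU by (rule Least_le)
      moreover have "d \<noteq> 0" using False by auto
      then have "degree P = degree U + degree V"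
        using lead eq
        by (metis degree_mult_eq degree_smult_eq dvd_0_right leading_coeff_0_iff mult_eq_0_iff smult_eq_0_iff)
      ultimately have "i < degree P" using deg by linarith
      then have "r dvd coeff (U * V) i" using low by (simp flip: eq)
      moreover have "coeff (U * V) i = (\<Sum>j<i. coeff U j * coeff V (i - j)) + coeff U i * coeff V 0"
        by (simp add: coeff_mult lessThan_Suc_atMost[symmetric])
      moreover have "r dvd (\<Sum>j<i. coeff U j * coeff V (i - j))"
        using less by (intro dvd_sum) auto
      ultimately have "r dvd coeff U i * coeff V 0" by (simp add: dvd_add_right_iff)
      then show False using r i V0 by (simp add: prime_elem_dvd_mult_iff)
    qed
    have c0: "d * coeff P 0 = coeff A 0 * coeff B 0"
      using arg_cong[OF Suc.prems(2), of "\<lambda>P. coeff P 0"] by (simp add: coeff_mult)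
    have "\<not> r dvd coeff A 0 \<or> \<not> r dvd coeff B 0"
    proof (rule ccontr)
      assume *: "\<not> ?thesis"
      then have "r * r dvd d * coeff P 0" unfolding c0 by (auto intro: mult_dvd_mono)
      moreover have "degree P \<noteq> 0"
        using * False c0 lead r by (metis dvd_mult2 prime_elem_dvd_mult_iff)
      then obtain w where w: "coeff P 0 = r * w" using low[of 0] by (auto elim: dvdE)
      ultimately have "r dvd d * w" using r0 by (simp add: algebra_simps)
      then have "r dvd w" using r False by (simp add: prime_elem_dvd_mult_iff)
      then show False using const w by (simp add: power2_eq_square)
    qed
    then show ?thesis
      using main[OF Suc.prems(2)] main[of B A] Suc.prems(2) by (auto simp: mult.commute)
  qed
qed

lemma eisenstein:
  fixes P :: "'a::idom poly"
  assumes r: "prime_elem r"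
    and sep: "\<And>d. d \<noteq> 0 \<Longrightarrow> \<exists>n. \<not> r ^ n dvd d"
    and deg: "degree P > 0"
    and low: "\<And>i. i < degree P \<Longrightarrow> r dvd coeff P i"
    and lead: "\<not> r dvd lead_coeff P"
    and const: "\<not> r\<^sup>2 dvd coeff P 0"
  shows "prime_elem (fract_poly P)"
proof (rule field_poly_irreducible_imp_prime, rule irreducibleI)
  show nonzero: "fract_poly P \<noteq> 0" using deg by auto
  then show "\<not> fract_poly P dvd 1" using deg by (simp add: is_unit_iff_degree degree_map_poly)
  fix A B assume AB: "fract_poly P = A * B"
  obtain a A' where A': "a \<noteq> 0" "smult (to_fract a) A = fract_poly A'"
    by (rule common_denominator)
  obtain b B' where B': "b \<noteq> 0" "smult (to_fract b) B = fract_poly B'"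
    by (rule common_denominator)
  have "fract_poly (smult (a * b) P) = fract_poly (A' * B')"
    by (simp add: AB mult.commute flip: A' B')
  then have eq: "smult (a * b) P = A' * B'" by (simp only: fract_poly_eq_iff)
  obtain n where n: "\<not> r ^ n dvd a * b" using sep[of "a * b"] A' B' by auto
  have "degree A' = 0 \<or> degree B' = 0"
    by (rule eisenstein_integral[OF r n eq low lead const])
  moreover have "degree A = degree A'" "degree B = degree B'"
    using arg_cong[OF A'(2), of degree] arg_cong[OF B'(2), of degree] A'(1) B'(1)
    by (simp_all add: degree_map_poly)
  moreover have "A \<noteq> 0" "B \<noteq> 0" using AB nonzero by auto
  ultimately show "A dvd 1 \<or> B dvd 1" by (auto simp: is_unit_iff_degree)
qed

lemma prime_power_mult_split:
  fixes x y z q :: "'a::idom"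
  assumes q: "prime_elem q" and eq: "x * y = q ^ a * z"
  obtains a1 a2 x' y' where "a = a1 + a2" "x = q ^ a1 * x'" "y = q ^ a2 * y'" "x' * y' = z"
proof -
  have "\<exists>a1 a2 x' y'. a = a1 + a2 \<and> x = q ^ a1 * x' \<and> y = q ^ a2 * y' \<and> x' * y' = z"
    using eq
  proof (induction a arbitrary: x y)
    case 0
    then show ?case by (intro exI[of _ 0] exI[of _ x] exI[of _ y]) simp
  next
    case (Suc a)
    have q0: "q \<noteq> 0" using q by auto
    have "q dvd x * y" using Suc.prems by simp
    then consider x1 where "x = q * x1" | y1 where "y = q * y1"
      using q by (auto simp: prime_elem_dvd_mult_iff elim!: dvdE)
    then show ?case
    proof cases
      case 1
      then have "x1 * y = q ^ a * z" using Suc.prems q0 by (simp add: mult.assoc)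
      from Suc.IH[OF this] obtain a1 a2 x' y'
        where "a = a1 + a2" "x1 = q ^ a1 * x'" "y = q ^ a2 * y'" "x' * y' = z" by blast
      then show ?thesis using 1
        by (intro exI[of _ "Suc a1"] exI[of _ a2] exI[of _ x'] exI[of _ y']) (simp add: mult.assoc)
    next
      case 2
      then have "q * (x * y1) = q * (q ^ a * z)" using Suc.prems by (simp add: algebra_simps)
      then have "x * y1 = q ^ a * z" using q0 by simp
      from Suc.IH[OF this] obtain a1 a2 x' y'
        where "a = a1 + a2" "x = q ^ a1 * x'" "y1 = q ^ a2 * y'" "x' * y' = z" by blast
      then show ?thesis using 2
        by (intro exI[of _ a1] exI[of _ "Suc a2"] exI[of _ x'] exI[of _ y']) (simp add: mult.assoc)
    qed
  qed
  then show ?thesis using that by blast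
qed

lemma prime_power_dvd_mult_le:
  fixes q c :: "'a::idom"
  assumes "prime_elem q" "\<not> q dvd c" "q ^ n dvd q ^ k * c"
  shows "n \<le> k"
proof (rule ccontr)
  assume "\<not> n \<le> k"
  then have "q ^ Suc k dvd q ^ k * c"
    using assms(3) by (meson dvd_trans le_imp_power_dvd not_less_eq_eq)
  then show False using assms(1,2) by (simp add: mult.commute[of q])
qed

section \<open>Three irreducible polynomials\<close>

text \<open>
  What the construction uses of \<open>D\<close>: a prime \<open>p\<close> for which the exponent of the group of nonzero
  residues divides \<open>m\<close>, and a second prime \<open>r\<close>, not associated to \<open>p\<close>, at which Eisenstein's criterion
  is applied; \<open>r_sep\<close> is the finiteness that this criterion requires.
\<close>

locale prime_pair =
  fixes p r :: "'a::idom" and m N :: nat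
  assumes p: "prime_elem p" and r: "prime_elem r"
    and p_ndvd_r: "\<not> p dvd r" and r_ndvd_p: "\<not> r dvd p"
    and m: "m > 0" and fermat: "\<And>d. \<not> p dvd d \<Longrightarrow> p dvd d ^ m - 1"
    and r_sep: "\<And>d. d \<noteq> 0 \<Longrightarrow> \<exists>n. \<not> r ^ n dvd d"
    and N: "N \<ge> 2"
begin

text \<open>
  The constant terms are chosen for their exact \<open>p\<close>-adic valuations and, in \<open>g\<close> and \<open>h\<close>, for
  Eisenstein's criterion at \<open>r\<close>. The remaining coefficients make the values at \<open>1\<close> equal to \<open>1\<close>, \<open>1\<close> and \<open>p ^ N\<close>.
  In \<open>h\<close> the term \<open>(x ^ m - 1) ^ N\<close> provides \<open>p ^ N\<close> at all arguments prime to \<open>p\<close>, and the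
  leading term is there because all coefficients of the other one are divisible by \<open>r\<close>.
\<close>

definition f :: "'a poly" where
  "f = [:p, 1 - p:]"

definition g :: "'a poly" where
  "g = monom (1 - p ^ (N - 1) * r) N + [:p ^ (N - 1) * r:]"

definition h :: "'a poly" where
  "h = monom (p ^ N) (m * N + 1) + smult r ((monom 1 m - 1) ^ N)"

lemma p_nonzero [simp]: "p \<noteq> 0" and r_nonzero [simp]: "r \<noteq> 0"
  using p r by auto

lemma fgh_at_0: "poly f 0 = p" "poly g 0 = p ^ (N - 1) * r" "poly h 0 = r * (- 1) ^ N"
  using m N by (simp_all add: f_def g_def h_def poly_monom zero_power)

lemma fgh_at_1: "poly f 1 = 1" "poly g 1 = 1" "poly h 1 = p ^ N"
  using N by (simp_all add: f_def g_def h_def poly_monom)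

lemma dvd_poly_f: "p dvd d \<Longrightarrow> p dvd poly f d"
  by (simp add: f_def)

lemma dvd_poly_g:
  assumes "p dvd d"
  shows "p ^ (N - 1) dvd poly g d"
proof -
  have "p ^ (N - 1) dvd d ^ N"
    using assms by (meson diff_le_self dvd_power_same dvd_trans le_imp_power_dvd)
  then show ?thesis by (simp add: g_def poly_monom)
qed

lemma dvd_poly_h:
  assumes "\<not> p dvd d"
  shows "p ^ N dvd poly h d"
proof -
  have "p ^ N dvd (d ^ m - 1) ^ N" using fermat[OF assms] by (rule dvd_power_same)
  then show ?thesis by (simp add: h_def poly_monom)
qed

lemma r_ndvd_p_power: "\<not> r dvd p ^ k"
  using r r_ndvd_p prime_elem_dvd_power by blast

lemma not_unit: "\<not> p dvd 1" "\<not> r dvd 1"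
  using p r prime_elem_not_unit by blast+

lemma prime_f: "prime_elem (fract_poly f)"
proof (rule field_poly_irreducible_imp_prime, rule irreducibleI)
  have "degree f = 1" using not_unit by (auto simp: f_def)
  then have deg: "degree (fract_poly f) = 1" by (simp add: degree_map_poly)
  then show nonzero: "fract_poly f \<noteq> 0" by auto
  then show "\<not> fract_poly f dvd 1" using deg by (simp add: is_unit_iff_degree)
  fix A B assume AB: "fract_poly f = A * B"
  then have AB0: "A \<noteq> 0" "B \<noteq> 0" using nonzero by auto
  then have "degree A + degree B = 1" using AB deg by (simp add: degree_mult_eq)
  then show "A dvd 1 \<or> B dvd 1" using AB0 by (auto simp: is_unit_iff_degree)
qed

lemma g_lead: "\<not> r dvd 1 - p ^ (N - 1) * r"
  using not_unit(2) dvd_diff[of r "1 - p ^ (N - 1) * r" "- (p ^ (N - 1) * r)"] by auto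

lemma coeff_g: "coeff g i = (if i = N then 1 - p ^ (N - 1) * r else if i = 0 then p ^ (N - 1) * r else 0)"
  using N by (auto simp: g_def coeff_pCons split: nat.splits)

lemma degree_g: "degree g = N"
proof (rule antisym)
  show "degree g \<le> N" by (rule degree_le) (use N in \<open>auto simp: coeff_g\<close>)
  show "N \<le> degree g" by (rule le_degree) (use g_lead in \<open>auto simp: coeff_g\<close>)
qed

lemma r_square: "\<not> r\<^sup>2 dvd r * c \<longleftrightarrow> \<not> r dvd c"
  by (simp add: power2_eq_square)

text \<open>
  The constant term of \<open>g\<close> has to be divisible by \<open>p ^ (N - 1)\<close>, which for \<open>N > 2\<close> rules out Eisenstein's
  criterion at \<open>p\<close>. Therefore a second prime \<open>r\<close> is built into the constant term.
\<close>

lemma prime_g: "prime_elem (fract_poly g)"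
proof (rule eisenstein[OF r r_sep])
  show "\<not> r\<^sup>2 dvd coeff g 0"
    using N r_square[of "p ^ (N - 1)"] r_ndvd_p_power by (simp add: coeff_g mult.commute)
qed (use N g_lead in \<open>auto simp: degree_g coeff_g\<close>)

lemma degree_h_tail: "degree ((monom 1 m - 1 :: 'a poly) ^ N) \<le> m * N"
proof -
  have "degree (monom 1 m - 1 :: 'a poly) \<le> m"
    by (rule degree_diff_le) (auto intro: degree_monom_le)
  then show ?thesis by (meson degree_power_le le_trans mult_le_mono1)
qed

lemma coeff_h_top: "coeff h (m * N + 1) = p ^ N"
  using degree_h_tail by (simp add: h_def coeff_eq_0)

lemma degree_h: "degree h = m * N + 1"
proof (rule antisym)
  show "degree h \<le> m * N + 1"
    unfolding h_def using degree_h_tail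
    by (intro degree_add_le degree_monom_le order_trans[OF degree_smult_le]) simp
  show "m * N + 1 \<le> degree h" by (rule le_degree) (simp add: coeff_h_top del: Suc_eq_plus1 add_Suc_right One_nat_def)
qed

lemma prime_h: "prime_elem (fract_poly h)"
proof (rule eisenstein[OF r r_sep])
  show "r dvd coeff h i" if "i < degree h" for i
    using that unfolding degree_h by (simp add: h_def)
  show "\<not> r dvd lead_coeff h" using r_ndvd_p_power by (simp add: degree_h coeff_h_top del: One_nat_def)
  have "\<not> r dvd (- 1) ^ N"
    using not_unit(2) by (cases "even N") auto
  then show "\<not> r\<^sup>2 dvd coeff h 0"
    using fgh_at_0(3) r_square by (simp add: poly_0_coeff_0)
qed (simp_all add: degree_h)

end

section \<open>The ring of integer-valued polynomials\<close>

abbreviation (input) unit_multiple :: "'a::idom fract poly \<Rightarrow> 'a fract poly \<Rightarrow> bool" where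
  "unit_multiple x y \<equiv> \<exists>s. s dvd 1 \<and> x = smult (to_fract s) y"

lemma Int_ring_times_closed:
  "F \<in> carrier Int_ring \<Longrightarrow> G \<in> carrier Int_ring \<Longrightarrow> F * G \<in> carrier (Int_ring :: 'a::idom fract poly ring)"
  using monoid.m_closed[OF ring.axioms(2)[OF cring.axioms(1)[OF domain.axioms(1)[OF domain_Int_ring]]]]
  by (metis Int_ring_simps(2))

lemma Int_ring_foldr_closed:
  "set cs \<subseteq> carrier Int_ring \<Longrightarrow> foldr (*) cs 1 \<in> carrier (Int_ring :: 'a::idom fract poly ring)"
proof (induction cs)
  case Nil
  show ?case by (rule Int_ring_carrierI) (metis foldr.simps(1) id_apply poly_1 to_fract_1)
next
  case (Cons c cs)
  then show ?case using Int_ring_times_closed[of c "foldr (*) cs 1"] by simp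
qed

lemma Int_ring_const: "[:to_fract s:] \<in> carrier Int_ring"
  by (rule Int_ring_carrierI) auto

lemma Int_ring_const_unit:
  assumes "s dvd 1"
  shows "[:to_fract s:] \<in> Units (Int_ring :: 'a::idom fract poly ring)"
proof -
  obtain t where "s * t = 1" using assms by (auto elim: dvdE)
  then have "[:to_fract s:] * [:to_fract t:] = 1"
    by (simp add: mult.commute one_pCons flip: to_fract_mult)
  then have "[:to_fract s:] \<otimes>\<^bsub>Int_ring\<^esub> [:to_fract t:] = \<one>\<^bsub>Int_ring\<^esub>"
    "[:to_fract t:] \<otimes>\<^bsub>Int_ring\<^esub> [:to_fract s:] = \<one>\<^bsub>Int_ring\<^esub>"
    unfolding Int_ring_simps by (simp_all only: mult.commute)
  then show ?thesis
    unfolding Units_def using Int_ring_const[of s] Int_ring_const[of t] by blast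
qed

lemma Int_ring_unit_degree:
  assumes "u \<in> Units (Int_ring :: 'a::idom fract poly ring)"
  shows "degree u = 0" "u \<noteq> 0"
proof -
  obtain v where uv: "v * u = 1" using assms by (auto simp: Units_def)
  then show "u \<noteq> 0" by auto
  then have "degree (v * u) = degree v + degree u" using uv by (intro degree_mult_eq) auto
  then show "degree u = 0" using uv by simp
qed

lemma Int_ring_pow: "F [^]\<^bsub>Int_ring\<^esub> (n::nat) = F ^ n"
  by (induction n) (simp_all add: nat_pow_def mult.commute)

lemma Int_ring_foldr: "foldr (\<otimes>\<^bsub>Int_ring\<^esub>) cs \<one>\<^bsub>Int_ring\<^esub> = foldr (*) cs 1"
  by (induction cs) simp_all

lemma unit_multiple_associated:
  assumes "x \<in> carrier Int_ring" "y \<in> carrier Int_ring" "unit_multiple x y"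
  shows "x \<sim>\<^bsub>Int_ring\<^esub> y"
proof -
  obtain s where s: "s dvd 1" "x = [:to_fract s:] * y" using assms(3) by auto
  then show ?thesis
    unfolding domain.ring_associated_iff[OF domain_Int_ring assms(1,2)] Int_ring_simps(2)
    using Int_ring_const_unit[OF s(1)] by blast
qed

lemma associated_degree:
  assumes "x \<in> carrier Int_ring" "y \<in> carrier Int_ring" "x \<sim>\<^bsub>Int_ring\<^esub> y"
  shows "degree x = degree y"
proof -
  obtain u where u: "u \<in> Units Int_ring" "x = u * y"
    using assms(3) unfolding domain.ring_associated_iff[OF domain_Int_ring assms(1,2)] Int_ring_simps(2)
    by blast
  then show ?thesis
    using Int_ring_unit_degree[OF u(1)] by (cases "y = 0") (auto simp: degree_mult_eq)
qed

section \<open>The integer-valued products of the three polynomials\<close>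

context prime_pair
begin

text \<open>
  Equivalent to \<open>a \<equiv> b\<close> modulo \<open>N\<close>. In this form the quotient is the exponent of \<open>h\<close>
  for which the two lower bounds for the \<open>p\<close>-adic valuation agree.
\<close>

definition balanced :: "nat \<Rightarrow> nat \<Rightarrow> bool" where
  "balanced a b \<longleftrightarrow> N dvd a + (N - 1) * b"

definition h_exp :: "nat \<Rightarrow> nat \<Rightarrow> nat" where
  "h_exp a b = (a + (N - 1) * b) div N"

text \<open>
  For balanced pairs and \<open>N > 2\<close> these elements form a copy of the block monoid of the residues
  modulo \<open>N\<close> over \<open>{1, -1}\<close>, that is, of the monoid of sequences of terms \<open>1\<close> and \<open>-1\<close> with sum
  \<open>0\<close>: \<open>a\<close> counts the terms \<open>1\<close> and \<open>b\<close> the terms \<open>-1\<close>.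
\<close>

definition block :: "nat \<Rightarrow> nat \<Rightarrow> 'a fract poly" where
  "block a b = smult (inverse (to_fract (p ^ (N * h_exp a b)))) (fract_poly (f ^ a * g ^ b * h ^ h_exp a b))"

lemma N_pos [simp]: "N > 0" "N \<noteq> 0"
  using N by auto

lemma h_exp_eq: "balanced a b \<Longrightarrow> N * h_exp a b = a + (N - 1) * b"
  by (simp add: balanced_def h_exp_def)

lemma h_exp_unique: "N * e = a + (N - 1) * b \<Longrightarrow> h_exp a b = e"
  unfolding h_exp_def by (metis N_pos(2) nonzero_mult_div_cancel_left)

lemma balancedI: "N * e = a + (N - 1) * b \<Longrightarrow> balanced a b"
  unfolding balanced_def by (metis dvd_triv_left)

lemma balanced_wt_add:
  assumes "balanced a b" "balanced a' b'"
  shows "balanced (a + a') (b + b')" "h_exp (a + a') (b + b') = h_exp a b + h_exp a' b'"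
proof -
  have "N * (h_exp a b + h_exp a' b') = (a + a') + (N - 1) * (b + b')"
    unfolding distrib_left assms[THEN h_exp_eq] by (rule add.assoc[THEN trans]) (simp only: ac_simps)
  then show "balanced (a + a') (b + b')" "h_exp (a + a') (b + b') = h_exp a b + h_exp a' b'"
    using balancedI h_exp_unique by blast+
qed

lemma balanced_diff:
  assumes "balanced a b" "balanced a' b'" "a' \<le> a" "b' \<le> b"
  shows "balanced (a - a') (b - b')"
proof -
  have "a + (N - 1) * b - (a' + (N - 1) * b') = (a - a') + (N - 1) * (b - b')"
    using assms(3,4) mult_le_mono2[OF assms(4), of "N - 1"] by (simp add: diff_mult_distrib2)
  then show ?thesis using assms(1,2) unfolding balanced_def by (metis dvd_diff_nat)
qed

lemma balanced_diag [simp]: "balanced n n" and h_exp_diag [simp]: "h_exp n n = n"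
proof -
  have "N * n = n + (N - 1) * n" using N by (cases N) auto
  then show "balanced n n" "h_exp n n = n" using balancedI h_exp_unique by blast+
qed

lemma balanced_cases:
  assumes "balanced a b" "a \<le> N" "b \<le> N"
  shows "a = b \<or> (a = N \<and> b = 0) \<or> (a = 0 \<and> b = N)"
proof -
  have Nb: "N * b = b + (N - 1) * b" using N by (cases N) auto
  show ?thesis
  proof (cases a b rule: linorder_cases)
    case less
    have "N * b - (a + (N - 1) * b) = b - a" using Nb by simp
    then have "N dvd b - a"
      using assms(1) unfolding balanced_def by (metis dvd_diff_nat dvd_triv_left)
    then have "N \<le> b - a" using less by (intro dvd_imp_le) auto
    then show ?thesis using assms less by auto
  next
    case greater
    have "a + (N - 1) * b - N * b = a - b" using Nb by simp
    then have "N dvd a - b"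
      using assms(1) unfolding balanced_def by (metis dvd_diff_nat dvd_triv_left)
    then have "N \<le> a - b" using greater by (intro dvd_imp_le) auto
    then show ?thesis using assms greater by auto
  qed simp
qed

lemma balanced_N: "balanced N 0" "balanced 0 N"
  by (simp_all add: balanced_def)

lemma block_0 [simp]: "block 0 0 = 1"
  by (simp add: block_def h_exp_def)

lemma block_add:
  assumes "balanced a b" "balanced a' b'"
  shows "block (a + a') (b + b') = block a b * block a' b'"
  by (simp add: block_def balanced_wt_add[OF assms] power_add distrib_left to_fract_power
      fract_poly_power algebra_simps)

lemma block_power: "block n n = block 1 1 ^ n"
proof (induction n)
  case (Suc n)
  have "block (Suc n) (Suc n) = block 1 1 * block n n" using block_add[of 1 1 n n] by simp
  then show ?case by (simp only: Suc.IH power_Suc)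
qed simp

lemma degree_f: "degree f = 1"
  using not_unit by (auto simp: f_def)

lemma fgh_nonzero [simp]: "f \<noteq> 0" "g \<noteq> 0" "h \<noteq> 0"
  using degree_f degree_g degree_h N by auto

lemma degree_block: "degree (block a b) = a + N * b + (m * N + 1) * h_exp a b"
  by (simp add: block_def degree_map_poly degree_mult_eq degree_power_eq degree_f degree_g degree_h)

lemma block_nonzero [simp]: "block a b \<noteq> 0"
  by (simp add: block_def fract_poly_power del: to_fract_mult)

lemma degree_block_eq_0: "degree (block a b) = 0 \<longleftrightarrow> a = 0 \<and> b = 0"
  by (auto simp: degree_block h_exp_def)

text \<open>
  At an argument divisible by \<open>p\<close> the denominator is absorbed by the values of \<open>f\<close> and \<open>g\<close>,
  at any other argument by the value of \<open>h\<close>.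
\<close>

lemma block_carrier:
  assumes "balanced a b"
  shows "block a b \<in> carrier Int_ring"
proof (rule Int_ring_carrierI)
  fix d
  let ?e = "h_exp a b"
  have "p ^ (N * ?e) dvd poly (f ^ a * g ^ b * h ^ ?e) d"
  proof (cases "p dvd d")
    case True
    have "p ^ (a + (N - 1) * b) dvd poly f d ^ a * poly g d ^ b"
      unfolding power_add power_mult
      by (intro mult_dvd_mono dvd_power_same dvd_poly_f dvd_poly_g True)
    then show ?thesis using h_exp_eq[OF assms] by (simp add: dvd_mult2)
  next
    case False
    have "p ^ (N * ?e) dvd poly h d ^ ?e"
      unfolding power_mult by (intro dvd_power_same dvd_poly_h False)
    then show ?thesis by simp
  qed
  then obtain c where "poly (f ^ a * g ^ b * h ^ ?e) d = p ^ (N * ?e) * c" by (elim dvdE)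
  then have "poly (block a b) (to_fract d) = to_fract c"
    unfolding block_def poly_smult poly_fract_poly by simp
  then show "\<exists>c. poly (block a b) (to_fract d) = to_fract c" ..
qed

text \<open>
  The part of the value of \<open>f ^ a * g ^ b * h ^ e\<close> at \<open>0\<close> that remains, up to the unit \<open>s\<close>, when the powers
  of \<open>p\<close> are removed.
\<close>

lemma p_ndvd_rest:
  assumes "s dvd 1"
  shows "\<not> p dvd s * (r ^ b * (r * (- 1) ^ N) ^ e)"
proof -
  have "\<not> p dvd s" using assms not_unit(1) dvd_trans by blast
  moreover have "\<not> p dvd r ^ b" using p p_ndvd_r prime_elem_dvd_power by blast
  moreover have "\<not> p dvd r * (- 1) ^ N" using p_ndvd_r by (cases "even N") auto
  then have "\<not> p dvd (r * (- 1) ^ N) ^ e" using p prime_elem_dvd_power by blast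
  ultimately show ?thesis using p by (simp add: prime_elem_dvd_mult_iff)
qed

lemma value_at_1:
  assumes "x = fract_poly f ^ a * (fract_poly g ^ b * (fract_poly h ^ e * [:\<gamma>:]))"
  shows "poly x 1 = to_fract (p ^ (N * e)) * \<gamma>"
proof -
  have "poly (fract_poly f) 1 = 1" "poly (fract_poly g) 1 = 1" "poly (fract_poly h) 1 = to_fract (p ^ N)"
    using poly_fract_poly[of f 1] poly_fract_poly[of g 1] poly_fract_poly[of h 1]
    by (simp_all add: fgh_at_1)
  then show ?thesis by (simp add: assms power_mult to_fract_power)
qed

text \<open>
  The value at \<open>1\<close> shows that the scalar is a unit over \<open>p ^ (N * e)\<close>. At \<open>0\<close> the value of
  \<open>f ^ a * g ^ b * h ^ e\<close> has \<open>p\<close>-adic valuation exactly \<open>a + (N - 1) * b\<close>, and since \<open>x\<close> takes a value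
  in \<open>D\<close> there, this valuation must make up for the denominator.
\<close>

lemma weight_bound:
  assumes x: "x \<in> carrier Int_ring"
    and x_eq: "x = fract_poly f ^ a * (fract_poly g ^ b * (fract_poly h ^ e * [:\<gamma>:]))"
    and s: "s dvd 1" "poly x 1 = to_fract s"
  shows "N * e \<le> a + (N - 1) * b"
proof -
  have \<gamma>: "to_fract (p ^ (N * e)) * \<gamma> = to_fract s"
    using value_at_1[OF x_eq] s(2) by simp
  obtain t where t: "poly x (to_fract 0) = to_fract t"
    using x unfolding Int_ring_simps(1) by blast
  have "poly (fract_poly f) 0 = to_fract p" "poly (fract_poly g) 0 = to_fract (p ^ (N - 1) * r)"
    "poly (fract_poly h) 0 = to_fract (r * (- 1) ^ N)"
    using poly_fract_poly[of f 0] poly_fract_poly[of g 0] poly_fract_poly[of h 0]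
    by (simp_all add: fgh_at_0)
  then have "to_fract t = to_fract (p ^ a * (p ^ (N - 1) * r) ^ b * (r * (- 1) ^ N) ^ e) * \<gamma>"
    using t by (simp add: x_eq to_fract_power ac_simps)
  then have "to_fract (p ^ (N * e) * t) = to_fract (p ^ a * (p ^ (N - 1) * r) ^ b * (r * (- 1) ^ N) ^ e * s)"
    unfolding to_fract_mult[of _ s] \<gamma>[symmetric] by (simp add: algebra_simps)
  then have "p ^ (N * e) * t = p ^ a * (p ^ (N - 1) * r) ^ b * (r * (- 1) ^ N) ^ e * s"
    by (simp only: to_fract_eq_iff)
  also have "\<dots> = p ^ (a + (N - 1) * b) * (s * (r ^ b * (r * (- 1) ^ N) ^ e))"
    unfolding power_mult_distrib power_add power_mult by (simp only: ac_simps)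
  finally have "p ^ (N * e) dvd p ^ (a + (N - 1) * b) * (s * (r ^ b * (r * (- 1) ^ N) ^ e))"
    by (metis dvd_triv_left)
  then show ?thesis by (rule prime_power_dvd_mult_le[OF p p_ndvd_rest[OF s(1)]])
qed

lemma unit_multiple_block:
  assumes "x = fract_poly f ^ a * (fract_poly g ^ b * (fract_poly h ^ e * [:\<gamma>:]))"
    and "poly x 1 = to_fract s" "N * e = a + (N - 1) * b"
  shows "x = smult (to_fract s) (block a b)"
proof -
  have "\<gamma> = to_fract s * inverse (to_fract (p ^ (N * e)))"
    using value_at_1[OF assms(1)] assms(2) by (simp add: field_simps)
  then show ?thesis
    using h_exp_unique[OF assms(3)] by (simp add: assms(1) block_def fract_poly_power algebra_simps)
qed

text \<open>
  Unique factorization over the quotient field makes both factors scalar multiples of products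
  of powers of \<open>f\<close>, \<open>g\<close>, \<open>h\<close>. Evaluation at \<open>1\<close> forces both scalars to be units over powers of \<open>p\<close>,
  and evaluation at \<open>0\<close> bounds both powers. The two bounds add up to an equality, because
  the exponents of the product are balanced, so each of them is an equality. Hence a
  factorization in the ring of integer-valued polynomials is a decomposition of the
  exponent pair in the monoid of balanced pairs.
\<close>

lemma split_block:
  assumes x: "x \<in> carrier Int_ring" and y: "y \<in> carrier Int_ring"
    and ab: "balanced a b" and s: "s dvd 1"
    and eq: "x * y = smult (to_fract s) (block a b)"
  obtains a1 b1 a2 b2 where "a = a1 + a2" "b = b1 + b2" "balanced a1 b1" "balanced a2 b2"
    "unit_multiple x (block a1 b1)" "unit_multiple y (block a2 b2)"
proof -
  let ?f = "fract_poly f" and ?g = "fract_poly g" and ?h = "fract_poly h"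
  define e where "e = h_exp a b"
  define \<gamma> where "\<gamma> = to_fract s * inverse (to_fract (p ^ (N * e)))"
  have xy: "x * y = ?f ^ a * (?g ^ b * (?h ^ e * [:\<gamma>:]))"
    by (simp add: eq block_def \<gamma>_def e_def fract_poly_power algebra_simps)
  obtain a1 a2 x1 y1 where 1: "a = a1 + a2" "x = ?f ^ a1 * x1" "y = ?f ^ a2 * y1"
    "x1 * y1 = ?g ^ b * (?h ^ e * [:\<gamma>:])"
    by (rule prime_power_mult_split[OF prime_f xy])
  obtain b1 b2 x2 y2 where 2: "b = b1 + b2" "x1 = ?g ^ b1 * x2" "y1 = ?g ^ b2 * y2"
    "x2 * y2 = ?h ^ e * [:\<gamma>:]"
    by (rule prime_power_mult_split[OF prime_g 1(4)])
  obtain e1 e2 x3 y3 where 3: "e = e1 + e2" "x2 = ?h ^ e1 * x3" "y2 = ?h ^ e2 * y3"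
    "x3 * y3 = [:\<gamma>:]"
    by (rule prime_power_mult_split[OF prime_h 2(4)])
  have "s \<noteq> 0" using s by auto
  then have "\<gamma> \<noteq> 0" by (simp add: \<gamma>_def)
  then have xy3: "x3 \<noteq> 0" "y3 \<noteq> 0" using 3(4) by auto
  have "degree x3 + degree y3 = 0" using arg_cong[OF 3(4), of degree] xy3 by (simp add: degree_mult_eq)
  then obtain \<gamma>1 \<gamma>2 where \<gamma>s: "x3 = [:\<gamma>1:]" "y3 = [:\<gamma>2:]"
    by (metis add_is_0 degree_eq_zeroE)
  have x_eq: "x = ?f ^ a1 * (?g ^ b1 * (?h ^ e1 * [:\<gamma>1:]))"
    and y_eq: "y = ?f ^ a2 * (?g ^ b2 * (?h ^ e2 * [:\<gamma>2:]))"
    using 1 2 3 \<gamma>s by simp_all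
  obtain s1 s2 where s12: "poly x 1 = to_fract s1" "poly y 1 = to_fract s2"
    using x y by (metis (mono_tags, lifting) Int_ring_simps(1) imageE mem_Collect_eq to_fract_1)
  have "to_fract (s1 * s2) = poly (x * y) 1" using s12 by simp
  also have "\<dots> = to_fract s" unfolding value_at_1[OF xy] by (simp add: \<gamma>_def)
  finally have "s1 * s2 = s" by (simp only: to_fract_eq_iff)
  then have units: "s1 dvd 1" "s2 dvd 1" using s by (auto dest: dvd_mult_left dvd_mult_right)
  have "N * e1 \<le> a1 + (N - 1) * b1" "N * e2 \<le> a2 + (N - 1) * b2"
    using weight_bound[OF x x_eq units(1) s12(1)] weight_bound[OF y y_eq units(2) s12(2)] .
  moreover have "N * e1 + N * e2 = (a1 + (N - 1) * b1) + (a2 + (N - 1) * b2)"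
    using h_exp_eq[OF ab, folded e_def] unfolding 1(1) 2(1) 3(1) distrib_left by linarith
  ultimately have wts: "N * e1 = a1 + (N - 1) * b1" "N * e2 = a2 + (N - 1) * b2" by linarith+
  show ?thesis
    using that[OF 1(1) 2(1) balancedI[OF wts(1)] balancedI[OF wts(2)]]
      unit_multiple_block[OF x_eq s12(1) wts(1)] unit_multiple_block[OF y_eq s12(2) wts(2)] units by blast
qed

lemma split_block_list:
  assumes "set cs \<subseteq> carrier Int_ring" "balanced a b"
    and "unit_multiple (foldr (*) cs 1) (block a b)"
  shows "\<exists>ts. list_all2 (\<lambda>c (a, b). balanced a b \<and> unit_multiple c (block a b)) cs ts \<and>
    sum_list (map fst ts) = a \<and> sum_list (map snd ts) = b"
  using assms
proof (induction cs arbitrary: a b)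
  case Nil
  then obtain s where s: "s dvd 1" "1 = smult (to_fract s) (block a b)" by auto
  then have "degree (block a b) = 0" by (metis degree_1 degree_smult_eq mult_zero_left smult_0_left one_neq_zero)
  then show ?case by (intro exI[of _ "[]"]) (simp add: degree_block_eq_0)
next
  case (Cons c cs)
  then obtain s where s: "s dvd 1" "c * foldr (*) cs 1 = smult (to_fract s) (block a b)" by auto
  have carr: "c \<in> carrier Int_ring" "foldr (*) cs 1 \<in> carrier Int_ring"
    using Cons.prems(1) Int_ring_foldr_closed[of cs] by auto
  obtain a1 b1 a2 b2 where *: "a = a1 + a2" "b = b1 + b2" "balanced a1 b1" "balanced a2 b2"
    "unit_multiple c (block a1 b1)" "unit_multiple (foldr (*) cs 1) (block a2 b2)"
    by (rule split_block[OF carr Cons.prems(2) s])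
  obtain ts where "list_all2 (\<lambda>c (a, b). balanced a b \<and> unit_multiple c (block a b)) cs ts"
    "sum_list (map fst ts) = a2" "sum_list (map snd ts) = b2"
    using Cons.IH[OF _ *(4,6)] Cons.prems(1) by auto
  then show ?case using * by (intro exI[of _ "(a1, b1) # ts"]) auto
qed

end

section \<open>Factorizations of the powers of the irreducible element\<close>

context prime_pair
begin

definition indecomposable :: "nat \<Rightarrow> nat \<Rightarrow> bool" where
  "indecomposable a b \<longleftrightarrow> \<not> (a = 0 \<and> b = 0) \<and>
    (\<forall>a' b'. a' \<le> a \<and> b' \<le> b \<and> balanced a' b' \<longrightarrow> (a' = 0 \<and> b' = 0) \<or> (a' = a \<and> b' = b))"

lemma list_all2_in_set1:
  "list_all2 P xs ys \<Longrightarrow> x \<in> set xs \<Longrightarrow> \<exists>y\<in>set ys. P x y"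
  by (induction rule: list_all2_induct) auto

lemma list_all2_in_set2:
  "list_all2 P xs ys \<Longrightarrow> y \<in> set ys \<Longrightarrow> \<exists>x\<in>set xs. P x y"
  by (induction rule: list_all2_induct) auto

lemma unit_multiple_block_Units:
  assumes "unit_multiple x (block a b)"
  shows "x \<in> Units Int_ring \<longleftrightarrow> a = 0 \<and> b = 0"
proof -
  obtain s where s: "s dvd 1" "x = smult (to_fract s) (block a b)" using assms by auto
  then have "s \<noteq> 0" by auto
  then have "degree x = degree (block a b)" by (simp add: s)
  then show ?thesis
    using Int_ring_unit_degree[of x] degree_block_eq_0[of a b] Int_ring_const_unit[OF s(1)]
    by (auto simp: s(2) smult_one)
qed

lemma irreducible_block_iff:
  assumes x: "x \<in> carrier Int_ring" and ab: "balanced a b" and xE: "unit_multiple x (block a b)"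
  shows "ring_irreducible\<^bsub>Int_ring\<^esub> x \<longleftrightarrow> indecomposable a b"
proof
  interpret Int: domain "Int_ring :: 'a fract poly ring" by (rule domain_Int_ring)
  obtain s where s: "s dvd 1" "x = smult (to_fract s) (block a b)" using xE by auto
  show "indecomposable a b" if irr: "ring_irreducible\<^bsub>Int_ring\<^esub> x"
    unfolding indecomposable_def
  proof (intro conjI allI impI)
    show "\<not> (a = 0 \<and> b = 0)"
      using Int.ring_irreducibleE(4)[OF x irr] unit_multiple_block_Units[OF xE] by blast
    fix a' b' assume a'b': "a' \<le> a \<and> b' \<le> b \<and> balanced a' b'"
    then have diff: "balanced (a - a') (b - b')" using balanced_diff ab by blast
    define y where "y = smult (to_fract s) (block a' b')"
    define z where "z = block (a - a') (b - b')"
    have "x = y * z" using block_add[OF _ diff, of a' b'] a'b' by (simp add: s(2) y_def z_def)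
    moreover have "y \<in> carrier Int_ring"
      using Int_ring_times_closed[OF Int_ring_const[of s] block_carrier[of a' b']] a'b' by (simp add: y_def)
    moreover have "z \<in> carrier Int_ring" unfolding z_def by (rule block_carrier[OF diff])
    ultimately have "y \<in> Units Int_ring \<or> z \<in> Units Int_ring"
      using Int.ring_irreducibleE(5)[OF x irr] by (metis Int_ring_simps(2))
    moreover have "unit_multiple y (block a' b')" unfolding y_def using s(1) by blast
    moreover have "unit_multiple z (block (a - a') (b - b'))"
      unfolding z_def by (intro exI[of _ 1]) simp
    ultimately have "(a' = 0 \<and> b' = 0) \<or> (a - a' = 0 \<and> b - b' = 0)"
      using unit_multiple_block_Units by blast
    then show "(a' = 0 \<and> b' = 0) \<or> (a' = a \<and> b' = b)" using a'b' by auto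
  qed
  show "ring_irreducible\<^bsub>Int_ring\<^esub> x" if ind: "indecomposable a b"
  proof (rule Int.ring_irreducibleI)
    have "s \<noteq> 0" using s(1) by auto
    then show "x \<in> carrier Int_ring - {\<zero>\<^bsub>Int_ring\<^esub>}" using x s(2) by simp
    show "x \<notin> Units Int_ring"
      using unit_multiple_block_Units[OF xE] ind by (auto simp: indecomposable_def)
    fix y z assume yz: "y \<in> carrier Int_ring" "z \<in> carrier Int_ring" "x = y \<otimes>\<^bsub>Int_ring\<^esub> z"
    then have "y * z = smult (to_fract s) (block a b)" using s(2) by simp
    from split_block[OF yz(1,2) ab s(1) this] obtain a1 b1 a2 b2 where
      *: "a = a1 + a2" "b = b1 + b2" "balanced a1 b1" "balanced a2 b2"
      "unit_multiple y (block a1 b1)" "unit_multiple z (block a2 b2)" .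
    have "(a1 = 0 \<and> b1 = 0) \<or> (a1 = a \<and> b1 = b)"
      using ind *(3) le_add1[of a1 a2] le_add1[of b1 b2] unfolding indecomposable_def *(1,2) by blast
    then show "y \<in> Units Int_ring \<or> z \<in> Units Int_ring"
      using *(1,2) unit_multiple_block_Units[OF *(5)] unit_multiple_block_Units[OF *(6)] by auto
  qed
qed

lemma indecomposable_cases:
  assumes "indecomposable a b" "balanced a b" "a \<le> N" "b \<le> N"
  shows "(a, b) \<in> {(1, 1), (N, 0), (0, N)}"
proof -
  consider "a = b" | "a = N" "b = 0" | "a = 0" "b = N" using balanced_cases[OF assms(2-4)] by blast
  then show ?thesis
  proof cases
    case 1
    have "b \<noteq> 0" using assms(1) 1 by (auto simp: indecomposable_def)
    then have "1 \<le> a \<and> 1 \<le> b \<and> balanced 1 1" using 1 by simp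
    then have "1 = a" using assms(1) unfolding indecomposable_def by (metis one_neq_zero)
    then show ?thesis using 1 by simp
  qed auto
qed

lemma indecomposable_block: "indecomposable 1 1" "indecomposable N 0" "indecomposable 0 N"
proof -
  show "indecomposable N 0" "indecomposable 0 N"
    unfolding indecomposable_def using balanced_cases by fastforce+
  have "a' = b'" if "balanced a' b'" "a' \<le> 1" "b' \<le> 1" for a' b'
    using balanced_cases[OF that(1)] that N by auto
  then show "indecomposable 1 1" unfolding indecomposable_def by fastforce
qed

lemma unit_multiple_refl: "unit_multiple x x"
  by (intro exI[of _ 1]) simp

lemma ring_irreducible_block:
  assumes "balanced a b" "indecomposable a b"
  shows "ring_irreducible\<^bsub>Int_ring\<^esub> (block a b)"
  using irreducible_block_iff[OF block_carrier[OF assms(1)] assms(1) unit_multiple_refl] assms(2) by blast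

text \<open>
  The irreducible factors of \<open>block n n\<close> correspond to indecomposable balanced pairs below \<open>(n, n)\<close>, and
  for \<open>n \<le> N\<close> there are at most three of these.
\<close>

lemma factorization_block:
  assumes cs: "cs \<in> factorizations Int_ring (block n n)" and n: "n \<le> N"
  obtains ts where "list_all2 (\<sim>\<^bsub>Int_ring\<^esub>) cs (map (\<lambda>(a, b). block a b) ts)"
    "sum_list (map fst ts) = n" "sum_list (map snd ts) = n"
    "\<forall>t\<in>set ts. fst t \<le> n \<and> snd t \<le> n \<and> t \<in> {(1, 1), (N, 0), (0, N)}"
proof -
  have carr: "set cs \<subseteq> carrier Int_ring" and prod: "foldr (*) cs 1 = block n n"
    and irr: "c \<in> set cs \<Longrightarrow> Divisibility.irreducible Int_ring c" for c
    using cs Int_ring_foldr[of cs] unfolding factorizations_def factors_def by auto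
  obtain ts where ts: "list_all2 (\<lambda>c (a, b). balanced a b \<and> unit_multiple c (block a b)) cs ts"
    "sum_list (map fst ts) = n" "sum_list (map snd ts) = n"
    using split_block_list[OF carr balanced_diag[of n]] unit_multiple_refl unfolding prod by blast
  have 1: "list_all2 (\<sim>\<^bsub>Int_ring\<^esub>) cs (map (\<lambda>(a, b). block a b) ts)"
    unfolding list_all2_map2 using ts(1)
  proof (rule list.rel_mono_strong)
    fix c ab assume "c \<in> set cs" and "case ab of (a, b) \<Rightarrow> balanced a b \<and> unit_multiple c (block a b)"
    then show "c \<sim>\<^bsub>Int_ring\<^esub> (case ab of (a, b) \<Rightarrow> block a b)"
      using carr unit_multiple_associated[of c] block_carrier by (auto simp del: Int_ring_simps(1))
  qed
  have 2: "a \<le> n \<and> b \<le> n \<and> (a, b) \<in> {(1, 1), (N, 0), (0, N)}" if ab: "(a, b) \<in> set ts" for a b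
  proof -
    have le: "a \<le> n" "b \<le> n"
      using member_le_sum_list[of a "map fst ts"] member_le_sum_list[of b "map snd ts"] ab ts(2,3)
      by force+
    obtain c where c: "c \<in> set cs" "balanced a b" "unit_multiple c (block a b)"
      using list_all2_in_set2[OF ts(1) ab] by auto
    have "c \<noteq> 0" using c(3) by auto
    then have "ring_irreducible\<^bsub>Int_ring\<^esub> c"
      using irr[OF c(1)] by (simp add: ring_irreducible_def)
    then have "indecomposable a b" using irreducible_block_iff[OF _ c(2,3)] carr c(1) by blast
    then show ?thesis using indecomposable_cases c(2) le n by auto
  qed
  show ?thesis by (rule that[OF 1 ts(2,3)]) (use 2 in auto)
qed

lemma replicate_pairI:
  "set ts \<subseteq> {(1, 1)} \<Longrightarrow> ts = replicate (sum_list (map fst ts)) (1 :: nat, 1 :: nat)"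
  by (induction ts) auto

text \<open>
  The pair \<open>(n, 0)\<close> already exhausts the first sum, so that only copies of \<open>(0, n)\<close> can join it,
  and the second sum admits exactly one.
\<close>

lemma pairs_sum_cases:
  fixes n :: nat
  assumes sums: "sum_list (map fst ts) = n" "sum_list (map snd ts) = n"
    and ts: "set ts \<subseteq> {(1, 1), (n, 0), (0, n)}" and n: "n > 0"
  shows "ts = replicate n (1, 1) \<or> ts = [(n, 0), (0, n)] \<or> ts = [(0, n), (n, 0)]"
proof (cases "(n, 0) \<in> set ts")
  case True
  then obtain xs ys where xy: "ts = xs @ (n, 0) # ys" by (meson split_list)
  have "t = (0, n)" if t: "t \<in> set (xs @ ys)" for t
  proof -
    have "sum_list (map fst (xs @ ys)) = 0" using sums(1) by (simp add: xy)
    then have "fst t = 0" using t by (auto simp: sum_list_eq_0_iff)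
    moreover have "t \<in> {(1, 1), (n, 0), (0, n)}" using t ts by (auto simp: xy)
    ultimately show ?thesis using n by auto
  qed
  then have rep: "xs @ ys = replicate (length (xs @ ys)) (0, n)" by (intro replicate_eqI) auto
  have "sum_list (map snd (xs @ ys)) = n" using sums(2) by (simp add: xy)
  then have "length (xs @ ys) * n = n"
    by (subst (asm) rep) (simp add: sum_list_replicate del: length_append)
  then have "length (xs @ ys) = 1" using n by simp
  then have "xs @ ys = [(0, n)]" using rep by simp
  then show ?thesis by (auto simp: xy append_eq_Cons_conv)
next
  case False
  have "(0, n) \<notin> set ts"
  proof
    assume "(0, n) \<in> set ts"
    then obtain xs ys where xy: "ts = xs @ (0, n) # ys" by (meson split_list)
    have "\<not> t \<in> set (xs @ ys)" for t
    proof
      assume t: "t \<in> set (xs @ ys)"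
      have "sum_list (map snd (xs @ ys)) = 0" using sums(2) by (simp add: xy)
      then have "snd t = 0" using t by (auto simp: sum_list_eq_0_iff)
      moreover have "t \<in> {(1, 1), (0, n)}" using t ts False by (auto simp: xy)
      ultimately show False using n by auto
    qed
    then have "xs @ ys = []" by (metis list.set_intros(1) neq_Nil_conv)
    then show False using sums(1) n by (simp add: xy)
  qed
  then have "set ts \<subseteq> {(1, 1)}" using False ts by auto
  then show ?thesis using replicate_pairI sums(1) by metis
qed

lemma block_factorizations:
  "replicate n (block 1 1) \<in> factorizations Int_ring (block n n)"
  "[block N 0, block 0 N] \<in> factorizations Int_ring (block N N)"
proof -
  have mem: "cs \<in> factorizations Int_ring (foldr (*) cs 1)"
    if "\<And>c. c \<in> set cs \<Longrightarrow> \<exists>a b. balanced a b \<and> indecomposable a b \<and> c = block a b" for cs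
  proof -
    have "c \<in> carrier Int_ring \<and> Divisibility.irreducible Int_ring c" if "c \<in> set cs" for c
      using \<open>\<And>c. c \<in> set cs \<Longrightarrow> _\<close>[OF that] block_carrier ring_irreducible_block
      unfolding ring_irreducible_def by blast
    then show ?thesis unfolding factorizations_def factors_def Int_ring_foldr by blast
  qed
  have "foldr (*) (replicate n (block 1 1)) 1 = block n n"
    unfolding block_power[of n] by (induction n) simp_all
  moreover have "replicate n (block 1 1) \<in> factorizations Int_ring (foldr (*) (replicate n (block 1 1)) 1)"
    using balanced_diag[of 1] indecomposable_block(1) by (intro mem) (metis in_set_replicate)
  ultimately show "replicate n (block 1 1) \<in> factorizations Int_ring (block n n)" by (simp only:)
  have "foldr (*) [block N 0, block 0 N] 1 = block N N" using block_add[OF balanced_N] by simp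
  moreover have "[block N 0, block 0 N] \<in> factorizations Int_ring (foldr (*) [block N 0, block 0 N] 1)"
    using balanced_N indecomposable_block(2,3) by (intro mem) (auto simp del: One_nat_def)
  ultimately show "[block N 0, block 0 N] \<in> factorizations Int_ring (block N N)" by (simp only:)
qed

text \<open>
  For \<open>n < N\<close> the corners \<open>(N, 0)\<close> and \<open>(0, N)\<close> are too large to divide \<open>(n, n)\<close>; for \<open>n = N\<close> they
  fit in exactly once each. The resulting factorization differs from the power of
  \<open>block 1 1\<close> even when both have length \<open>2\<close>, because \<open>block N 0\<close> and \<open>block 1 1\<close> have different degrees.
\<close>

lemma exists_irreducible_with_two_factorizations:
  "\<exists>F \<in> carrier (Int_ring :: 'a fract poly ring). ring_irreducible\<^bsub>Int_ring\<^esub> F \<and>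
    (\<forall>n. 0 < n \<and> n < N \<longrightarrow> factors_uniquely Int_ring (F [^]\<^bsub>Int_ring\<^esub> n)) \<and>
    (\<exists>cs \<in> factorizations Int_ring (F [^]\<^bsub>Int_ring\<^esub> N).
     \<exists>ds \<in> factorizations Int_ring (F [^]\<^bsub>Int_ring\<^esub> N).
       length cs = 2 \<and> length ds = N \<and> \<not> essentially_equal Int_ring cs ds \<and>
       (\<forall>es \<in> factorizations Int_ring (F [^]\<^bsub>Int_ring\<^esub> N).
          essentially_equal Int_ring es cs \<or> essentially_equal Int_ring es ds))"
proof (intro bexI[of _ "block 1 1"] conjI allI impI)
  have pow: "block 1 1 [^]\<^bsub>Int_ring\<^esub> n = block n n" for n :: nat by (simp only: Int_ring_pow block_power[of n])
  show "block 1 1 \<in> carrier Int_ring" by (rule block_carrier[OF balanced_diag])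
  show "ring_irreducible\<^bsub>Int_ring\<^esub> (block 1 1)"
    by (rule ring_irreducible_block[OF balanced_diag indecomposable_block(1)])
  show "factors_uniquely Int_ring (block 1 1 [^]\<^bsub>Int_ring\<^esub> n)" if n: "0 < n \<and> n < N" for n
    unfolding factors_uniquely_def pow
  proof (intro bexI[of _ "replicate n (block 1 1)"] ballI)
    fix cs assume cs: "cs \<in> factorizations Int_ring (block n n)"
    have "n \<le> N" using n by simp
    from cs this obtain ts where ts: "list_all2 (\<sim>\<^bsub>Int_ring\<^esub>) cs (map (\<lambda>(a, b). block a b) ts)"
      "sum_list (map fst ts) = n" "sum_list (map snd ts) = n"
      "\<forall>t\<in>set ts. fst t \<le> n \<and> snd t \<le> n \<and> t \<in> {(1, 1), (N, 0), (0, N)}"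
      by (rule factorization_block)
    have one: "t = (1, 1)" if "t \<in> set ts" for t
      using ts(4) that n by (cases t) force
    then have "set ts \<subseteq> {(1, 1)}" by blast
    then have "ts = replicate n (1, 1)" using replicate_pairI ts(2) by metis
    then have "list_all2 (\<sim>\<^bsub>Int_ring\<^esub>) cs (replicate n (block 1 1))"
      using ts(1) by (simp add: map_replicate)
    then show "essentially_equal Int_ring cs (replicate n (block 1 1))"
      unfolding essentially_equal_def by blast
  qed (rule block_factorizations)
  show "\<exists>cs \<in> factorizations Int_ring (block 1 1 [^]\<^bsub>Int_ring\<^esub> N).
     \<exists>ds \<in> factorizations Int_ring (block 1 1 [^]\<^bsub>Int_ring\<^esub> N).
       length cs = 2 \<and> length ds = N \<and> \<not> essentially_equal Int_ring cs ds \<and>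
       (\<forall>es \<in> factorizations Int_ring (block 1 1 [^]\<^bsub>Int_ring\<^esub> N).
          essentially_equal Int_ring es cs \<or> essentially_equal Int_ring es ds)"
    unfolding pow
  proof (rule bexI[of _ "[block N 0, block 0 N]"], rule bexI[of _ "replicate N (block 1 1)"],
      intro conjI ballI)
    show "\<not> essentially_equal Int_ring [block N 0, block 0 N] (replicate N (block 1 1))"
    proof
      assume "essentially_equal Int_ring [block N 0, block 0 N] (replicate N (block 1 1))"
      then obtain cs where "mset [block N 0, block 0 N] = mset cs"
        and cs: "list_all2 (\<sim>\<^bsub>Int_ring\<^esub>) cs (replicate N (block 1 1))"
        unfolding essentially_equal_def by blast
      then have "block N 0 \<in> set cs" by (metis list.set_intros(1) set_mset_mset)
      then have "block N 0 \<sim>\<^bsub>Int_ring\<^esub> block 1 1" using list_all2_in_set1[OF cs] by fastforce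
      then have "degree (block N 0) = degree (block 1 1)"
        by (rule associated_degree[OF block_carrier[OF balanced_N(1)] block_carrier[OF balanced_diag]])
      moreover have "h_exp N 0 = 1" by (simp add: h_exp_def)
      ultimately show False by (simp add: degree_block del: One_nat_def)
    qed
    fix es assume "es \<in> factorizations Int_ring (block N N)"
    then obtain ts where ts: "list_all2 (\<sim>\<^bsub>Int_ring\<^esub>) es (map (\<lambda>(a, b). block a b) ts)"
      "sum_list (map fst ts) = N" "sum_list (map snd ts) = N"
      "\<forall>t\<in>set ts. fst t \<le> N \<and> snd t \<le> N \<and> t \<in> {(1, 1), (N, 0), (0, N)}"
      by (rule factorization_block[OF _ le_refl])
    have "set ts \<subseteq> {(1, 1), (N, 0), (0, N)}"
    proof
      fix t assume "t \<in> set ts"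
      then show "t \<in> {(1, 1), (N, 0), (0, N)}" using ts(4) by blast
    qed
    then consider "ts = replicate N (1, 1)" | "ts = [(N, 0), (0, N)]" | "ts = [(0, N), (N, 0)]"
      using pairs_sum_cases[OF ts(2,3) _ N_pos(1)] by blast
    then show "essentially_equal Int_ring es [block N 0, block 0 N] \<or>
        essentially_equal Int_ring es (replicate N (block 1 1))"
    proof cases
      case 1
      then have "list_all2 (\<sim>\<^bsub>Int_ring\<^esub>) es (replicate N (block 1 1))"
        using ts(1) by (simp add: map_replicate)
      then show ?thesis unfolding essentially_equal_def by blast
    next
      case 2
      then have "list_all2 (\<sim>\<^bsub>Int_ring\<^esub>) es [block N 0, block 0 N]"
        using ts(1) by (auto simp: list_all2_Cons2)
      then show ?thesis unfolding essentially_equal_def by blast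
    next
      case 3
      then obtain c d where "es = [c, d]" "c \<sim>\<^bsub>Int_ring\<^esub> block 0 N" "d \<sim>\<^bsub>Int_ring\<^esub> block N 0"
        using ts(1) by (auto simp: list_all2_Cons2)
      then have "mset es = mset [d, c]" "list_all2 (\<sim>\<^bsub>Int_ring\<^esub>) [d, c] [block N 0, block 0 N]" by auto
      then show ?thesis unfolding essentially_equal_def by blast
    qed
  qed (rule block_factorizations | simp)+
qed

end

theorem theorem1:
  fixes N :: nat
  defines "D \<equiv> (ring_of_type_algebra :: 'a::idom ring)"
    and "IntD \<equiv> (Int_ring :: 'a fract poly ring)"
  assumes pid: "principal_domain D"
    and primes: "infinite {P. primeideal P D \<and> finite (carrier (D Quot P))}"
    and N: "N \<ge> 2"
  shows "\<exists>F \<in> carrier IntD. ring_irreducible\<^bsub>IntD\<^esub> F \<and>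
    (\<forall>n. 0 < n \<and> n < N \<longrightarrow> factors_uniquely IntD (F [^]\<^bsub>IntD\<^esub> n)) \<and>
    (\<exists>cs \<in> factorizations IntD (F [^]\<^bsub>IntD\<^esub> N).
     \<exists>ds \<in> factorizations IntD (F [^]\<^bsub>IntD\<^esub> N).
       length cs = 2 \<and> length ds = N \<and> \<not> essentially_equal IntD cs ds \<and>
       (\<forall>es \<in> factorizations IntD (F [^]\<^bsub>IntD\<^esub> N).
          essentially_equal IntD es cs \<or> essentially_equal IntD es ds))"
proof -
  \<comment> \<open>The zero ideal has to be avoided: its generator is not a prime element.\<close>
  have avoid: "\<exists>P. primeideal P D \<and> finite (carrier (D Quot P)) \<and> P \<notin> A" if "finite A" for A
    using infinite_imp_nonempty[OF Diff_infinite_finite[OF that primes]] by blast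
  obtain P where P: "primeideal P D" "finite (carrier (D Quot P))" "P \<noteq> {0}"
    using avoid[of "{{0}}"] by auto
  obtain R where R: "primeideal R D" "R \<noteq> {0}" "R \<noteq> P"
    using avoid[of "{{0}, P}"] by auto
  obtain p where p: "prime_elem p" "P = {x. p dvd x}"
    by (rule prime_ideal_generator[OF pid[unfolded D_def] P(1)[unfolded D_def] P(3)])
  obtain r where r: "prime_elem r" "R = {x. r dvd x}"
    by (rule prime_ideal_generator[OF pid[unfolded D_def] R(1)[unfolded D_def] R(2)])
  obtain m where m: "m > 0" "\<And>d. \<not> p dvd d \<Longrightarrow> p dvd d ^ m - 1"
    using finite_residues_exponent[OF p(1) P(2)[unfolded p(2) D_def]] by blast
  have ndvd: "\<not> p dvd r" "\<not> r dvd p"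
    using R(3) p r prime_elem_dvd_prime_elem by (blast intro: dvd_trans)+
  have "\<exists>n. \<not> r ^ n dvd d" if "d \<noteq> 0" for d
    using pid_power_not_dvd[OF pid[unfolded D_def] prime_elem_not_unit[OF r(1)] that] .
  with p(1) r(1) m ndvd N interpret prime_pair p r m N by unfold_locales
  show ?thesis unfolding IntD_def by (rule exists_irreducible_with_two_factorizations)
qed

end
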